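(* Let $d, s \geq 1$ be integers, let $X$ be a subset of $\mathbb{R}^d$, let $K \subset \mathbb{C}$ be an algebraic number field, and let $A=\mathcal{O}_K$ be its ring of integers. Let $\mathfrak{p}$ be a nonzero prime ideal of $A$, and let $A_{\mathfrak{p}}$ be the localization of $A$ at $\mathfrak{p}$. Suppose $D(X) \subset A_{\mathfrak{p}}$. If there exist $a_1,\ldots, a_s \in A_{\mathfrak{p}}$, pairwise distinct modulo $\mathfrak{p}A_{\mathfrak{p}}$, such that (1) for each $i \in \{1,\ldots,s\}$, $a_i \not\equiv 0 \pmod{\mathfrak{p}A_{\mathfrak{p}}}$, and (2) for each $\alpha \in D(X)$, there exists $i \in \{1,\ldots,s\}$ such that $\alpha \equiv a_i \pmod{\mathfrak{p}A_{\mathfrak{p}}}$, then \[ |X| \leq \binom{d+s}{s}+\binom{d+s-1}{s-1}. \]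
   Context: For $X \subset \mathbb{R}^d$, $D(X)=\{\|x-y\|^2 : x,y\in X,\ x\neq y\}$ is the set of squared Euclidean distances between two distinct points of $X$. An algebraic number field $K$ is a finite extension of $\mathbb{Q}$; an embedding into $\mathbb{C}$ is fixed and $K$ is regarded as a subfield of $\mathbb{C}$, so that the real numbers in $D(X)$ and the elements of $K$ both lie in $\mathbb{C}$. $\mathcal{O}_K$ is the ring of all algebraic integers in $K$. For a prime ideal $\mathfrak{p}$ of $A=\mathcal{O}_K$, $A_{\mathfrak{p}}=\{a/s \in K \mid a\in A,\ s\in A\setminus\mathfrak{p}\}$, a local ring whose maximal ideal $\mathfrak{p}A_{\mathfrak{p}}$ is the ideal of $A_{\mathfrak{p}}$ generated by the elements of $\mathfrak{p}$. *)

theory Defs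
  imports "HOL-Analysis.Analysis" "HOL-Algebra.Algebraic_Closure_Type"
begin

definition squared_distances :: "(real ^ 'n) set \<Rightarrow> real set" where
  "squared_distances S = {(norm (x - y))\<^sup>2 | x y. x \<in> S \<and> y \<in> S \<and> x \<noteq> y}"

abbreviation complex_ring :: "complex ring" where
  "complex_ring \<equiv> ring_of_type_algebra"

abbreviation subset_ring :: "complex set \<Rightarrow> complex ring" where
  "subset_ring S \<equiv> complex_ring\<lparr>carrier := S\<rparr>"

text \<open>The embedding into the complex numbers is the inclusion; \<open>\<rat>\<close> is the copy of the
  rationals inside the complex numbers.\<close>

definition number_field :: "complex set \<Rightarrow> bool" where
  "number_field K \<longleftrightarrow>
     subfield K complex_ring \<and> ring.finite_dimension complex_ring \<rat> K"

definition ring_of_integers :: "complex set \<Rightarrow> complex set" where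
  "ring_of_integers K = {x \<in> K. algebraic_int x}"

text \<open>Localization of a subring \<open>A\<close> of the complex numbers at a prime ideal \<open>P\<close> of \<open>A\<close>, inside the
  fraction field of \<open>A\<close>. No division by zero occurs, since \<open>0 \<in> P\<close>.\<close>

definition localization_at :: "complex set \<Rightarrow> complex set \<Rightarrow> complex set" where
  "localization_at A P = {a / s | a s. a \<in> A \<and> s \<in> A - P}"

definition local_max_ideal :: "complex set \<Rightarrow> complex set \<Rightarrow> complex set" where
  "local_max_ideal A P = genideal (subset_ring (localization_at A P)) P"

definition cong_mod_ideal :: "complex \<Rightarrow> complex \<Rightarrow> complex set \<Rightarrow> bool" where
  "cong_mod_ideal x y I \<longleftrightarrow> x - y \<in> I"

end

theory Submission
  imports
    Defs
    "HOL-Library.Function_Algebras"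
    "Jordan_Normal_Form.Determinant"
begin

text \<open>
  For \<open>x \<in> S\<close> consider the polynomial \<open>F\<^sub>x(y) = \<Prod>\<^sub>i (\<bar>x - y\<bar>\<^sup>2 - a\<^sub>i)\<close>. The matrix of the values
  \<open>F\<^sub>x(y)\<close> for \<open>x, y \<in> S\<close> has all off-diagonal entries in the maximal ideal of the local ring and
  all diagonal entries outside it, so its determinant is nonzero. Its size is thus at most the
  dimension of any space that contains all \<open>F\<^sub>x\<close>. Every factor of \<open>F\<^sub>x\<close> is a linear form in
  \<open>1, \<bar>y\<bar>\<^sup>2, y\<^sub>1, \<dots>, y\<^sub>d\<close>, and the relation \<open>y\<^sub>1\<^sup>2 = 1 \<cdot> \<bar>y\<bar>\<^sup>2 - y\<^sub>2\<^sup>2 - \<dots> - y\<^sub>d\<^sup>2\<close> allows one to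
  keep the exponent of \<open>y\<^sub>1\<close> at most one. This leaves the monomials of degree \<open>s\<close> in
  \<open>1, \<bar>y\<bar>\<^sup>2, y\<^sub>2, \<dots>, y\<^sub>d\<close> and \<open>y\<^sub>1\<close> times those of degree \<open>s - 1\<close>.
\<close>

subsection \<open>Spans of functions\<close>

text \<open>Polynomials enter only as functions: spans are taken in the pointwise module over the
  coefficient ring, and \<open>*\<close> on functions is the pointwise product.\<close>

interpretation fun_space: Modules.module "\<lambda>(c :: 'b :: comm_ring_1) (f :: 'a \<Rightarrow> 'b) x. c * f x"
  by unfold_locales (auto simp: fun_eq_iff algebra_simps)

lemma sum_fun_apply: "(\<Sum>a\<in>A. f a) x = (\<Sum>a\<in>A. f a x)"
  for f :: "'a \<Rightarrow> 'b \<Rightarrow> 'c :: comm_monoid_add"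
  by (induction A rule: infinite_finite_induct) auto

lemma prod_fun_apply: "(\<Prod>a\<in>A. f a) x = (\<Prod>a\<in>A. f a x)"
  for f :: "'a \<Rightarrow> 'b \<Rightarrow> 'c :: comm_monoid_mult"
  by (induction A rule: infinite_finite_induct) auto

text \<open>By bilinearity: both factors are expanded over their generators, with one induction for
  each factor.\<close>

lemma fun_span_mult:
  fixes f g :: "'a \<Rightarrow> 'b :: comm_ring_1"
  assumes f: "f \<in> fun_space.span B" and g: "g \<in> fun_space.span C"
    and BC: "\<And>b c. b \<in> B \<Longrightarrow> c \<in> C \<Longrightarrow> b * c \<in> fun_space.span D"
  shows "f * g \<in> fun_space.span D"
  using f
proof (induction rule: fun_space.span_induct_alt)
  case base
  show ?case
    by (metis mult_zero_left fun_space.span_zero)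
next
  case (step k b f')
  have "b * g \<in> fun_space.span D"
    using g
  proof (induction rule: fun_space.span_induct_alt)
    case base
    show ?case
      by (metis mult_zero_right fun_space.span_zero)
  next
    case (step k c g')
    have "b * ((\<lambda>x. k * c x) + g') = (\<lambda>x. k * (b * c) x) + b * g'"
      by (auto simp: fun_eq_iff algebra_simps)
    also have "\<dots> \<in> fun_space.span D"
      by (intro fun_space.span_add fun_space.span_scale BC \<open>b \<in> B\<close> \<open>c \<in> C\<close> step)
    finally show ?case .
  qed
  then have "(\<lambda>x. k * (b * g) x) + f' * g \<in> fun_space.span D"
    by (intro fun_space.span_add fun_space.span_scale step)
  moreover have "((\<lambda>x. k * b x) + f') * g = (\<lambda>x. k * (b * g) x) + f' * g"
    by (auto simp: fun_eq_iff algebra_simps)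
  ultimately show ?case
    by metis
qed

text \<open>Expanding each \<open>F i\<close> over \<open>B\<close> factors the matrix into
  coefficients times values, with inner dimension \<open>card B < n\<close>. Multiplicativity of the
  determinant, valid over any commutative ring, takes the place of a rank argument.\<close>

lemma det_eq_0_if_small_span:
  fixes F :: "nat \<Rightarrow> 'a \<Rightarrow> 'b :: comm_ring_1"
  assumes "finite B" and small: "card B < n"
    and F: "\<And>i. i < n \<Longrightarrow> F i \<in> fun_space.span B"
  shows "det (mat n n (\<lambda>(i, j). F i (y j))) = 0"
proof -
  define N where "N = card B"
  obtain e where e: "bij_betw e {0..<N} B"
    using ex_bij_betw_nat_finite[OF \<open>finite B\<close>] unfolding N_def by blast
  have "\<exists>u. F i = (\<Sum>b\<in>B. (\<lambda>x. u b * b x))" if "i < n" for i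
    using F[OF that] fun_space.span_finite[OF \<open>finite B\<close>] by auto
  then obtain u where u: "\<And>i. i < n \<Longrightarrow> F i = (\<Sum>b\<in>B. (\<lambda>x. u i b * b x))"
    by metis
  \<comment> \<open>Columns of \<open>C\<close> and rows of \<open>D\<close> with index at least
    \<open>N\<close> are zero padding, which makes both factors square.\<close>
  define C where "C = mat n n (\<lambda>(i, k). if k < N then u i (e k) else 0)"
  define D where "D = mat n n (\<lambda>(k, j). if k < N then e k (y j) else 0)"
  have carr: "C \<in> carrier_mat n n" "D \<in> carrier_mat n n"
    by (auto simp: C_def D_def)
  have "mat n n (\<lambda>(i, j). F i (y j)) = C * D"
  proof (rule eq_matI)
    fix i j assume "i < dim_row (C * D)" "j < dim_col (C * D)"
    then have ij: "i < n" "j < n"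
      using carr by auto
    have "F i (y j) = (\<Sum>b\<in>B. u i b * b (y j))"
      using u[OF ij(1)] by (simp add: sum_fun_apply)
    also have "\<dots> = (\<Sum>k\<in>{0..<N}. u i (e k) * e k (y j))"
      by (rule sum.reindex_bij_betw[OF e, symmetric])
    also have "\<dots> = (\<Sum>k\<in>{0..<n}. (if k < N then u i (e k) else 0) * (if k < N then e k (y j) else 0))"
      using small by (intro sum.mono_neutral_cong_left) (auto simp: N_def)
    also have "\<dots> = (C * D) $$ (i, j)"
      using ij by (simp add: C_def D_def scalar_prod_def)
    finally show "mat n n (\<lambda>(i, j). F i (y j)) $$ (i, j) = (C * D) $$ (i, j)"
      using ij by simp
  qed (use carr in auto)
  moreover have "det D = 0"
  proof -
    \<comment> \<open>Row \<open>n - 1\<close> of \<open>D\<close> is padding because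
      \<open>N < n\<close>, so every Leibniz product contains a zero.\<close>
    have "(\<Prod>i = 0..<n. D $$ (i, p i)) = 0" if "p permutes {0..<n}" for p
      using small permutes_in_image[OF that, of "n - 1"]
      by (intro prod_zero bexI[of _ "n - 1"]) (auto simp: D_def N_def)
    then show ?thesis
      unfolding det_def'[OF carr(2)] by (intro sum.neutral) auto
  qed
  ultimately show ?thesis
    using det_mult[OF carr] by simp
qed

subsection \<open>Monomials modulo a quadratic relation\<close>

text \<open>The list \<open>l\<close> is the exponent vector. The elements are values in the monoid,
  so different exponent vectors may give the same one.\<close>

definition monomials :: "'v :: comm_monoid_mult list \<Rightarrow> nat \<Rightarrow> 'v set" where
  "monomials hs s =
     (\<lambda>l. \<Prod>k<length hs. (hs ! k) ^ (l ! k)) ` {l. length l = length hs \<and> sum_list l = s}"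

text \<open>The exponent of \<open>w\<close> is at most one. Writing \<open>Suc r = s\<close> makes
  the second set empty for \<open>s = 0\<close>, where \<open>s - 1\<close> would truncate to 0 and
  admit \<open>w\<close> itself.\<close>

definition reduced_monomials :: "'v :: comm_monoid_mult list \<Rightarrow> 'v \<Rightarrow> nat \<Rightarrow> 'v set" where
  "reduced_monomials hs w s = monomials hs s \<union> {w * f | f r. Suc r = s \<and> f \<in> monomials hs r}"

lemma finite_nat_lists_sum: "finite {l :: nat list. length l = m \<and> sum_list l = s}"
proof (rule finite_subset)
  show "{l :: nat list. length l = m \<and> sum_list l = s} \<subseteq> {l. set l \<subseteq> {..s} \<and> length l = m}"
    by (auto dest: member_le_sum_list)
qed (simp add: finite_lists_length_eq)

lemma finite_monomials: "finite (monomials hs s)"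
  unfolding monomials_def by (intro finite_imageI finite_nat_lists_sum)

text \<open>Stars and bars counts the exponent vectors; coincidences among their values can only
  lower the cardinality.\<close>

lemma card_monomials: "card (monomials hs s) \<le> (s + length hs - 1) choose s"
  unfolding monomials_def
  using card_image_le[OF finite_nat_lists_sum] by (simp add: card_length_sum_list)

text \<open>The exponent at one position of \<open>h\<close> in \<open>hs\<close> is raised by one;
  any such position will do if \<open>h\<close> is repeated.\<close>

lemma mult_in_monomials:
  assumes "h \<in> set hs" "f \<in> monomials hs s"
  shows "h * f \<in> monomials hs (Suc s)"
proof -
  obtain i where i: "i < length hs" "h = hs ! i"
    using assms(1) by (auto simp: in_set_conv_nth)
  obtain l where l: "length l = length hs" "sum_list l = s"
    "f = (\<Prod>k<length hs. (hs ! k) ^ (l ! k))"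
    using assms(2) by (auto simp: monomials_def)
  define l' where "l' = l[i := Suc (l ! i)]"
  have "(\<Prod>k<length hs. (hs ! k) ^ (l' ! k))
      = (hs ! i) ^ (l' ! i) * (\<Prod>k\<in>{..<length hs} - {i}. (hs ! k) ^ (l' ! k))"
    using i by (intro prod.remove) auto
  also have "(\<Prod>k\<in>{..<length hs} - {i}. (hs ! k) ^ (l' ! k))
      = (\<Prod>k\<in>{..<length hs} - {i}. (hs ! k) ^ (l ! k))"
    by (intro prod.cong) (auto simp: l'_def)
  also have "(hs ! i) ^ (l' ! i) * \<dots>
      = h * ((hs ! i) ^ (l ! i) * (\<Prod>k\<in>{..<length hs} - {i}. (hs ! k) ^ (l ! k)))"
    using i l by (simp add: l'_def mult.assoc)
  also have "(hs ! i) ^ (l ! i) * (\<Prod>k\<in>{..<length hs} - {i}. (hs ! k) ^ (l ! k)) = f"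
    unfolding l(3) using i by (intro prod.remove[symmetric]) auto
  finally have "h * f = (\<Prod>k<length hs. (hs ! k) ^ (l' ! k))" ..
  moreover have "length l' = length hs" "sum_list l' = Suc s"
    using i l by (auto simp: l'_def sum_list_update)
  ultimately show ?thesis
    unfolding monomials_def by blast
qed

lemma finite_reduced_monomials: "finite (reduced_monomials hs w s)"
proof -
  have "{w * f | f r. Suc r = s \<and> f \<in> monomials hs r} \<subseteq> (*) w ` monomials hs (s - 1)"
    by auto
  then have "finite {w * f | f r. Suc r = s \<and> f \<in> monomials hs r}"
    by (rule finite_subset) (intro finite_imageI finite_monomials)
  then show ?thesis
    unfolding reduced_monomials_def by (simp add: finite_monomials)
qed

lemma card_reduced_monomials:
  assumes "s \<ge> 1"
  shows "card (reduced_monomials hs w s)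
    \<le> ((s + length hs - 1) choose s) + ((s - 1 + length hs - 1) choose (s - 1))"
proof -
  have "reduced_monomials hs w s = monomials hs s \<union> (*) w ` monomials hs (s - 1)"
    using assms unfolding reduced_monomials_def by (cases s) auto
  then have "card (reduced_monomials hs w s) \<le> card (monomials hs s) + card ((*) w ` monomials hs (s - 1))"
    by (simp add: card_Un_le)
  also have "\<dots> \<le> card (monomials hs s) + card (monomials hs (s - 1))"
    by (simp add: card_image_le finite_monomials)
  finally show ?thesis
    using card_monomials[of hs s] card_monomials[of hs "s - 1"] by linarith
qed

text \<open>Only \<open>b = w\<close>, \<open>c = w * f\<close> produces a square of
  \<open>w\<close>. There \<open>w2\<close> turns \<open>w * w\<close> into quadratic terms in
  \<open>hs\<close>, and multiplying by \<open>f\<close> of degree \<open>s - 1\<close> gives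
  monomials of degree \<open>Suc s\<close>.\<close>

lemma mult_in_span_reduced_monomials:
  fixes w :: "'a \<Rightarrow> 'b :: comm_ring_1"
  assumes w2: "w * w \<in> fun_space.span {f * g | f g. f \<in> set hs \<and> g \<in> set hs}"
    and b: "b \<in> insert w (set hs)" and c: "c \<in> reduced_monomials hs w s"
  shows "b * c \<in> fun_space.span (reduced_monomials hs w (Suc s))"
proof -
  consider "b \<in> set hs" "c \<in> monomials hs s"
    | "b = w" "c \<in> monomials hs s"
    | f r where "b \<in> set hs" "c = w * f" "Suc r = s" "f \<in> monomials hs r"
    | f r where "b = w" "c = w * f" "Suc r = s" "f \<in> monomials hs r"
    using b c unfolding reduced_monomials_def by blast
  then show ?thesis
  proof cases
    case 1
    then show ?thesis
      by (auto simp: reduced_monomials_def intro!: fun_space.span_base mult_in_monomials)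
  next
    case 2
    then show ?thesis
      by (auto simp: reduced_monomials_def intro!: fun_space.span_base)
  next
    case 3
    then have "b * c = w * (b * f)" "b * f \<in> monomials hs s"
      using mult_in_monomials by (auto simp: mult.left_commute)
    then show ?thesis
      by (auto simp: reduced_monomials_def intro!: fun_space.span_base)
  next
    case 4
    have "(w * w) * f \<in> fun_space.span (reduced_monomials hs w (Suc s))"
    proof (rule fun_span_mult[OF w2])
      show "f \<in> fun_space.span {f}"
        by (simp add: fun_space.span_base)
      show "p * q \<in> fun_space.span (reduced_monomials hs w (Suc s))"
        if "p \<in> {f * g | f g. f \<in> set hs \<and> g \<in> set hs}" "q \<in> {f}" for p q
      proof -
        from that obtain g g' where "g \<in> set hs" "g' \<in> set hs" "p * q = g * (g' * f)"
          by (auto simp: mult.assoc)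
        then have "p * q \<in> monomials hs (Suc s)"
          using 4 mult_in_monomials by metis
        then show ?thesis
          by (auto simp: reduced_monomials_def intro!: fun_space.span_base)
      qed
    qed
    then show ?thesis
      using 4 by (simp add: mult.assoc)
  qed
qed

text \<open>Reducing after each new factor keeps the exponent of \<open>w\<close> from exceeding
  one.\<close>

lemma prod_linear_forms_in_span:
  fixes w :: "'a \<Rightarrow> 'b :: comm_ring_1"
  assumes w2: "w * w \<in> fun_space.span {f * g | f g. f \<in> set hs \<and> g \<in> set hs}"
    and L: "\<And>i. i < s \<Longrightarrow> L i \<in> fun_space.span (insert w (set hs))"
  shows "(\<Prod>i<s. L i) \<in> fun_space.span (reduced_monomials hs w s)"
  using L
proof (induction s)
  case 0
  have "(1 :: 'a \<Rightarrow> 'b) \<in> monomials hs 0"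
    unfolding monomials_def by (auto intro!: image_eqI[of _ _ "replicate (length hs) 0"])
  then have "1 \<in> fun_space.span (reduced_monomials hs w 0)"
    unfolding reduced_monomials_def by (intro fun_space.span_base UnI1)
  then show ?case
    by (metis lessThan_0 prod.empty)
next
  case (Suc s)
  have "L s * (\<Prod>i<s. L i) \<in> fun_space.span (reduced_monomials hs w (Suc s))"
    by (rule fun_span_mult[OF Suc.prems[of s] Suc.IH[OF Suc.prems]
          mult_in_span_reduced_monomials[OF w2]]) auto
  then show ?case
    by (metis mult.commute prod.lessThan_Suc)
qed

subsection \<open>Products of shifted squared distances\<close>

text \<open>One set \<open>B\<close> serves all centres \<open>x\<close>. The two binomials count
  the exponent vectors of degrees \<open>s\<close> and \<open>s - 1\<close> in
  \<open>DIM('a) + 1\<close> generators.\<close>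

lemma distance_polynomials_in_span:
  assumes "s \<ge> 1"
  obtains B :: "('a :: euclidean_space \<Rightarrow> complex) set"
  where "finite B"
    and "card B \<le> ((DIM('a) + s) choose s) + ((DIM('a) + s - 1) choose (s - 1))"
    and "\<And>x. (\<lambda>y. \<Prod>i=1..s. complex_of_real ((norm (x - y))\<^sup>2) - a i) \<in> fun_space.span B"
proof -
  \<comment> \<open>The coordinate along \<open>b0\<close> plays the role of \<open>w\<close> and is
    left out of \<open>hs\<close>.\<close>
  obtain b0 :: 'a where b0: "b0 \<in> Basis"
    using nonempty_Basis by blast
  obtain bs :: "'a list" where bs: "set bs = Basis - {b0}" "distinct bs"
    using finite_distinct_list[of "Basis - {b0}"] by auto
  define coord where "coord b y = complex_of_real (inner y b)" for b y :: 'a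
  define Q where "Q y = complex_of_real ((norm y)\<^sup>2)" for y :: 'a
  \<comment> \<open>The constant 1 homogenizes: each factor becomes a linear form, and
    \<open>Q\<close> can be read as the quadratic term \<open>1 * Q\<close>.\<close>
  define hs where "hs = 1 # Q # map coord bs"
  have "DIM('a) = Suc (length bs)"
    using distinct_card[OF bs(2)] bs(1) b0 card_Suc_Diff1[of Basis b0] by simp
  then have len: "length hs = DIM('a) + 1"
    by (simp add: hs_def)
  have set_hs: "set hs = insert 1 (insert Q (coord ` (Basis - {b0})))"
    by (simp add: hs_def bs)
  let ?V = "insert (coord b0) (set hs)"
  have coord_span: "coord b \<in> fun_space.span ?V" if "b \<in> Basis" for b
    using that by (intro fun_space.span_base) (auto simp: set_hs)
  have Q_eq: "Q y = (\<Sum>b\<in>Basis. coord b y * coord b y)" for y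
    unfolding Q_def coord_def by (simp add: power2_norm_eq_inner euclidean_inner[of y y])
  have "coord b0 * coord b0 = 1 * Q - (\<Sum>b\<in>Basis - {b0}. coord b * coord b)"
    using b0 by (auto simp: fun_eq_iff fun_diff_def sum_fun_apply Q_eq sum.remove[of Basis b0])
  also have "\<dots> \<in> fun_space.span {f * g | f g. f \<in> set hs \<and> g \<in> set hs}"
  proof (intro fun_space.span_diff fun_space.span_sum fun_space.span_base)
    have "1 \<in> set hs" "Q \<in> set hs"
      by (simp_all add: hs_def)
    then show "1 * Q \<in> {f * g | f g. f \<in> set hs \<and> g \<in> set hs}"
      by blast
    fix b assume "b \<in> Basis - {b0}"
    then have "coord b \<in> set hs"
      by (simp add: set_hs)
    then show "coord b * coord b \<in> {f * g | f g. f \<in> set hs \<and> g \<in> set hs}"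
      by blast
  qed
  finally have w2: "coord b0 * coord b0 \<in> fun_space.span {f * g | f g. f \<in> set hs \<and> g \<in> set hs}" .
  have factor: "(\<lambda>y. complex_of_real ((norm (x - y))\<^sup>2) - c) \<in> fun_space.span ?V" for x c
  proof -
    have "(\<lambda>y. complex_of_real ((norm (x - y))\<^sup>2) - c)
        = (\<lambda>y. (Q x - c) * 1 y) + Q - (\<Sum>b\<in>Basis. (\<lambda>y. (2 * coord b x) * coord b y))"
    proof
      fix y
      \<comment> \<open>For fixed \<open>x\<close> this expansion is linear in 1, \<open>Q\<close>
        and the coordinates of \<open>y\<close>.\<close>
      have "(norm (x - y))\<^sup>2 = (norm x)\<^sup>2 + (norm y)\<^sup>2 - 2 * (\<Sum>b\<in>Basis. inner x b * inner y b)"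
        unfolding euclidean_inner[of x y, symmetric]
        by (simp add: power2_norm_eq_inner inner_diff_left inner_diff_right inner_commute)
      then have "complex_of_real ((norm (x - y))\<^sup>2)
          = Q x + Q y - 2 * (\<Sum>b\<in>Basis. coord b x * coord b y)"
        unfolding Q_def coord_def by (simp only: of_real_diff of_real_add of_real_mult of_real_sum of_real_numeral)
      then have "complex_of_real ((norm (x - y))\<^sup>2) - c
          = (Q x - c) * 1 + Q y - (\<Sum>b\<in>Basis. 2 * coord b x * coord b y)"
        by (simp only: sum_distrib_left mult.assoc mult_1_right) (simp only: algebra_simps)
      then show "complex_of_real ((norm (x - y))\<^sup>2) - c
        = ((\<lambda>y. (Q x - c) * 1 y) + Q - (\<Sum>b\<in>Basis. (\<lambda>y. (2 * coord b x) * coord b y))) y"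
        by (simp only: minus_apply plus_fun_apply one_fun_apply sum_fun_apply)
    qed
    also have "\<dots> \<in> fun_space.span ?V"
    proof (intro fun_space.span_diff fun_space.span_add fun_space.span_sum)
      have "1 \<in> fun_space.span ?V"
        by (intro fun_space.span_base) (simp add: hs_def)
      then show "(\<lambda>y. (Q x - c) * 1 y) \<in> fun_space.span ?V"
        by (rule fun_space.span_scale)
      show "Q \<in> fun_space.span ?V"
        by (intro fun_space.span_base) (simp add: hs_def)
      show "(\<lambda>y. (2 * coord b x) * coord b y) \<in> fun_space.span ?V" if "b \<in> Basis" for b
        by (intro fun_space.span_scale coord_span that)
    qed
    finally show ?thesis .
  qed
  have "(\<lambda>y. \<Prod>i=1..s. complex_of_real ((norm (x - y))\<^sup>2) - a i)
      \<in> fun_space.span (reduced_monomials hs (coord b0) s)" for x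
  proof -
    have "(\<lambda>y. \<Prod>i=1..s. complex_of_real ((norm (x - y))\<^sup>2) - a i)
        = (\<Prod>i<s. (\<lambda>y. complex_of_real ((norm (x - y))\<^sup>2) - a (Suc i)))"
      by (simp only: fun_eq_iff prod_fun_apply prod.atLeast1_atMost_eq One_nat_def) simp
    also have "\<dots> \<in> fun_space.span (reduced_monomials hs (coord b0) s)"
      by (rule prod_linear_forms_in_span[OF w2 factor])
    finally show ?thesis .
  qed
  moreover have "card (reduced_monomials hs (coord b0) s)
    \<le> ((DIM('a) + s) choose s) + ((DIM('a) + s - 1) choose (s - 1))"
    using card_reduced_monomials[OF assms, of hs "coord b0"] assms by (simp add: len add.commute)
  ultimately show ?thesis
    using that[OF finite_reduced_monomials] by blast
qed

subsection \<open>Prime ideals in subrings of a domain\<close>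

text \<open>A prime ideal of a subring, phrased with the arithmetic of the ambient type so that
  matrices and determinants over that type apply directly.\<close>

locale subring_prime_ideal =
  fixes R I :: "'a :: idom set"
  assumes one_closed: "1 \<in> R" and uminus_closed: "x \<in> R \<Longrightarrow> - x \<in> R"
    and add_closed: "x \<in> R \<Longrightarrow> y \<in> R \<Longrightarrow> x + y \<in> R"
    and mult_closed: "x \<in> R \<Longrightarrow> y \<in> R \<Longrightarrow> x * y \<in> R"
    and ideal_subset: "I \<subseteq> R" and ideal_zero: "0 \<in> I"
    and ideal_add: "x \<in> I \<Longrightarrow> y \<in> I \<Longrightarrow> x + y \<in> I"
    and ideal_mult: "x \<in> R \<Longrightarrow> y \<in> I \<Longrightarrow> x * y \<in> I"
    and ideal_proper: "1 \<notin> I"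
    and ideal_prime: "x \<in> R \<Longrightarrow> y \<in> R \<Longrightarrow> x * y \<in> I \<Longrightarrow> x \<in> I \<or> y \<in> I"
begin

lemma ideal_uminus: "x \<in> I \<Longrightarrow> - x \<in> I"
  using ideal_mult[OF uminus_closed[OF one_closed], of x] by simp

lemma prod_closed: "(\<And>i. i \<in> A \<Longrightarrow> f i \<in> R) \<Longrightarrow> prod f A \<in> R"
  by (induction A rule: infinite_finite_induct) (auto intro: one_closed mult_closed)

lemma ideal_sum: "(\<And>i. i \<in> A \<Longrightarrow> f i \<in> I) \<Longrightarrow> sum f A \<in> I"
  by (induction A rule: infinite_finite_induct) (auto intro: ideal_zero ideal_add)

lemma prod_in_ideal:
  assumes "finite A" "\<And>i. i \<in> A \<Longrightarrow> f i \<in> R" "i \<in> A" "f i \<in> I"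
  shows "prod f A \<in> I"
proof -
  have "prod f A = prod f (A - {i}) * f i"
    using assms(1,3) by (simp add: prod.remove mult.commute)
  moreover have "prod f (A - {i}) \<in> R"
    using assms(2) by (intro prod_closed) simp
  ultimately show ?thesis
    using assms(4) by (simp add: ideal_mult)
qed

lemma prod_notin_ideal:
  assumes "finite A" "\<And>i. i \<in> A \<Longrightarrow> f i \<in> R - I"
  shows "prod f A \<notin> I"
  using assms
proof (induction A)
  case empty
  then show ?case
    by (simp add: ideal_proper)
next
  case (insert i A)
  then show ?case
    using ideal_prime[of "f i" "prod f A"] prod_closed[of A f] by auto
qed

text \<open>Modulo \<open>I\<close> the matrix is diagonal with nonzero entries in a domain. In the
  Leibniz formula a zero determinant would make the identity term minus a sum of elements of
  \<open>I\<close>, although primality keeps it outside \<open>I\<close>.\<close>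

lemma det_neq_0_if_diagonal_mod_ideal:
  assumes diag: "\<And>i. i < n \<Longrightarrow> f i i \<in> R - I"
    and off: "\<And>i j. i < n \<Longrightarrow> j < n \<Longrightarrow> i \<noteq> j \<Longrightarrow> f i j \<in> I"
  shows "det (mat n n (\<lambda>(i, j). f i j)) \<noteq> 0"
proof
  define M where "M = mat n n (\<lambda>(i, j). f i j)"
  define t where "t p = signof p * (\<Prod>i = 0..<n. M $$ (i, p i))" for p
  have M: "M $$ (i, j) = f i j" if "i < n" "j < n" for i j
    using that by (simp add: M_def)
  assume "det (mat n n (\<lambda>(i, j). f i j)) = 0"
  then have "(\<Sum>p | p permutes {0..<n}. t p) = 0"
    by (subst (asm) det_def'[of _ n]) (simp_all add: t_def M_def)
  then have "t id + (\<Sum>p\<in>{p. p permutes {0..<n}} - {id}. t p) = 0"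
    by (subst (asm) sum.remove[of _ id]) (auto simp: finite_permutations permutes_id)
  then have "t id = - (\<Sum>p\<in>{p. p permutes {0..<n}} - {id}. t p)"
    by (simp add: eq_neg_iff_add_eq_0)
  moreover have "t p \<in> I" if p: "p permutes {0..<n}" "p \<noteq> id" for p
  proof -
    \<comment> \<open>A moved point contributes an off-diagonal factor, which puts the whole product
      into \<open>I\<close>.\<close>
    obtain i where "p i \<noteq> i"
      using p(2) by (auto simp: fun_eq_iff)
    then have i: "i < n"
      using p(1) by (metis atLeastLessThan_iff permutes_not_in zero_le)
    have pn: "p k < n" if "k < n" for k
      using permutes_in_image[OF p(1), of k] that by simp
    have "(\<Prod>i = 0..<n. M $$ (i, p i)) \<in> I"
    proof (rule prod_in_ideal[of _ _ i])
      show "M $$ (k, p k) \<in> R" if "k \<in> {0..<n}" for k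
        using that pn[of k] diag[of k] off[of k "p k"] ideal_subset
        by (cases "p k = k") (auto simp: M)
      show "M $$ (i, p i) \<in> I"
        using i pn[OF i] \<open>p i \<noteq> i\<close> off[of i "p i"] by (simp add: M)
    qed (use i in auto)
    then show ?thesis
      using ideal_uminus by (auto simp: t_def sign_def)
  qed
  ultimately have "t id \<in> I"
    using ideal_uminus[OF ideal_sum[of "{p. p permutes {0..<n}} - {id}" t]] by simp
  moreover have "t id = (\<Prod>i = 0..<n. f i i)"
    by (simp add: t_def M)
  ultimately show False
    using prod_notin_ideal[of "{0..<n}" "\<lambda>i. f i i"] diag by simp
qed

end

subsection \<open>The localization at a prime ideal\<close>

text \<open>The dictionary for moving facts between the ring records and ordinary complex
  arithmetic.\<close>

lemma complex_ring_simps: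
  "carrier (subset_ring S) = S" "x \<otimes>\<^bsub>subset_ring S\<^esub> y = x * y"
  "x \<oplus>\<^bsub>subset_ring S\<^esub> y = x + y" "\<one>\<^bsub>subset_ring S\<^esub> = 1" "\<zero>\<^bsub>subset_ring S\<^esub> = 0"
  by (simp_all add: ring_of_type_algebra_def)

lemma ring_subset_ringD:
  assumes "ring (subset_ring S)"
  shows "1 \<in> S" "0 \<in> S" "x \<in> S \<Longrightarrow> - x \<in> S"
    and "x \<in> S \<Longrightarrow> y \<in> S \<Longrightarrow> x + y \<in> S" "x \<in> S \<Longrightarrow> y \<in> S \<Longrightarrow> x * y \<in> S"
proof -
  interpret ring "subset_ring S" by fact
  show "1 \<in> S" "0 \<in> S"
    using one_closed zero_closed by (simp_all only: complex_ring_simps)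
  show "x + y \<in> S" "x * y \<in> S" if "x \<in> S" "y \<in> S"
    using add.m_closed[of x y] m_closed[of x y] that by (simp_all only: complex_ring_simps)
  show "- x \<in> S" if "x \<in> S"
  proof -
    have "(\<ominus>\<^bsub>subset_ring S\<^esub> x) + x = 0" "(\<ominus>\<^bsub>subset_ring S\<^esub> x) \<in> S"
      using l_neg[of x] a_inv_closed[of x] that by (simp_all only: complex_ring_simps)
    then show ?thesis
      by (simp add: eq_neg_iff_add_eq_0[symmetric])
  qed
qed

lemma ring_subset_ringI:
  assumes "1 \<in> S" "\<And>x. x \<in> S \<Longrightarrow> - x \<in> S"
    and "\<And>x y. x \<in> S \<Longrightarrow> y \<in> S \<Longrightarrow> x + y \<in> S" "\<And>x y. x \<in> S \<Longrightarrow> y \<in> S \<Longrightarrow> x * y \<in> S"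
  shows "ring (subset_ring S)"
proof -
  have "0 \<in> S"
    using assms(3)[OF assms(1) assms(2)[OF assms(1)]] by simp
  moreover have "\<exists>y\<in>S. y + x = 0 \<and> x + y = 0" if "x \<in> S" for x
    using assms(2)[OF that] by (intro bexI[of _ "- x"]) auto
  ultimately show ?thesis
    using assms
    by (intro ringI abelian_groupI monoidI)
       (simp_all only: complex_ring_simps, auto simp: algebra_simps)
qed

text \<open>Closure under negation comes from multiplication by -1 in \<open>R\<close>.\<close>

lemma ideal_subset_ringI:
  assumes R: "ring (subset_ring R)" and J: "J \<subseteq> R" "0 \<in> J"
    and add: "\<And>x y. x \<in> J \<Longrightarrow> y \<in> J \<Longrightarrow> x + y \<in> J"
    and mult: "\<And>x y. x \<in> R \<Longrightarrow> y \<in> J \<Longrightarrow> x * y \<in> J"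
  shows "ideal J (subset_ring R)"
proof (rule idealI[OF R])
  interpret ring "subset_ring R" by fact
  have uminus: "\<ominus>\<^bsub>subset_ring R\<^esub> x \<in> J" if "x \<in> J" for x
  proof -
    have "x \<oplus>\<^bsub>subset_ring R\<^esub> (- x) = \<zero>\<^bsub>subset_ring R\<^esub>" "- x \<in> R" "x \<in> R"
      using that J ring_subset_ringD(3)[OF R, of x] by (simp_all only: complex_ring_simps) auto
    then have "\<ominus>\<^bsub>subset_ring R\<^esub> x = - x"
      by (intro minus_equality) (simp_all only: complex_ring_simps, simp)
    moreover have "- 1 * x \<in> J"
      using that ring_subset_ringD(1,3)[OF R] by (intro mult) auto
    ultimately show ?thesis
      by simp
  qed
  show "subgroup J (add_monoid (subset_ring R))"
  proof (rule add.subgroupI)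
    show "J \<subseteq> carrier (subset_ring R)" "J \<noteq> {}"
      using J by (auto simp only: complex_ring_simps)
    show "x \<oplus>\<^bsub>subset_ring R\<^esub> y \<in> J" if "x \<in> J" "y \<in> J" for x y
      using add[OF that] by (simp only: complex_ring_simps)
  qed (rule uminus)
  show "x \<otimes>\<^bsub>subset_ring R\<^esub> a \<in> J" "a \<otimes>\<^bsub>subset_ring R\<^esub> x \<in> J"
    if "a \<in> J" "x \<in> carrier (subset_ring R)" for a x
    using mult[of x a] that by (simp_all only: complex_ring_simps, simp add: mult.commute)
qed

text \<open>Properness and primality are pulled back to \<open>P\<close>: a fraction in the maximal
  ideal has its numerator in \<open>P\<close>, whichever representation is chosen.\<close>

lemma subring_prime_ideal_localization:
  assumes "primeideal P (subset_ring A)"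
  shows "subring_prime_ideal (localization_at A P) (local_max_ideal A P)"
proof -
  interpret P: primeideal P "subset_ring A" by fact
  define R where "R = localization_at A P"
  define M where "M = local_max_ideal A P"
  \<comment> \<open>An explicit ideal of fractions containing \<open>P\<close>; by minimality it
    contains the generated ideal \<open>M\<close>, whose elements thereby get a concrete
    form.\<close>
  define J where "J = {p / t | p t. p \<in> P \<and> t \<in> A - P}"
  note A = ring_subset_ringD[OF P.ring_axioms]
  have PA: "P \<subseteq> A"
    using P.a_subset by (simp only: complex_ring_simps)
  have P0: "0 \<in> P"
    using additive_subgroup.zero_closed[OF P.is_additive_subgroup] by (simp only: complex_ring_simps)
  have Padd: "x + y \<in> P" if "x \<in> P" "y \<in> P" for x y
    using additive_subgroup.a_closed[OF P.is_additive_subgroup, of x y] that by (simp only: complex_ring_simps)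
  have Pmult: "x * y \<in> P" if "x \<in> A" "y \<in> P" for x y
    using P.I_l_closed[of y x] that by (simp only: complex_ring_simps)
  have Pprime: "x \<in> P \<or> y \<in> P" if "x \<in> A" "y \<in> A" "x * y \<in> P" for x y
    using P.I_prime[of x y] that by (simp only: complex_ring_simps)
  have P1: "1 \<notin> P"
    using P.I_notcarr Pmult[of _ 1] PA by (auto simp only: complex_ring_simps mult_1_right)
  have denom: "s * t \<in> A - P" if "s \<in> A - P" "t \<in> A - P" for s t
    using that A(5) Pprime by blast
  have nz: "s \<noteq> 0" if "s \<in> A - P" for s
    using that P0 by auto
  have RI: "a / s \<in> R" if "a \<in> A" "s \<in> A - P" for a s
    using that unfolding R_def localization_at_def by blast
  have RE: "\<exists>a s. x = a / s \<and> a \<in> A \<and> s \<in> A - P" if "x \<in> R" for x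
    using that unfolding R_def localization_at_def by blast
  have R1: "1 \<in> R"
    using RI[of 1 1] A(1) P1 by simp
  have AR: "A \<subseteq> R"
    using RI[of _ 1] A(1) P1 by auto
  have Rminus: "- x \<in> R" if x: "x \<in> R" for x
  proof -
    obtain a s where "x = a / s" "a \<in> A" "s \<in> A - P"
      using RE[OF x] by blast
    then show ?thesis
      using RI[of "- a" s] A(3) by simp
  qed
  have Radd: "x + y \<in> R" if xy: "x \<in> R" "y \<in> R" for x y
  proof -
    obtain a s b t where "x = a / s" "a \<in> A" "s \<in> A - P" "y = b / t" "b \<in> A" "t \<in> A - P"
      using RE[OF xy(1)] RE[OF xy(2)] by blast
    then show ?thesis
      using RI[of "a * t + b * s" "s * t"] A(4,5) denom nz by (simp add: add_frac_eq)
  qed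
  have Rmult: "x * y \<in> R" if xy: "x \<in> R" "y \<in> R" for x y
  proof -
    obtain a s b t where "x = a / s" "a \<in> A" "s \<in> A - P" "y = b / t" "b \<in> A" "t \<in> A - P"
      using RE[OF xy(1)] RE[OF xy(2)] by blast
    then show ?thesis
      using RI[of "a * b" "s * t"] A(5) denom by simp
  qed
  have R: "ring (subset_ring R)"
    by (rule ring_subset_ringI) (fact R1, fact Rminus, fact Radd, fact Rmult)
  have "P \<subseteq> carrier (subset_ring R)"
    using PA AR by (auto simp only: complex_ring_simps)
  then have PM: "P \<subseteq> M" and "ideal M (subset_ring R)"
    using ring.genideal_self[OF R] ring.genideal_ideal[OF R]
    by (simp_all add: M_def R_def local_max_ideal_def)
  then interpret M: ideal M "subset_ring R"
    by simp
  have MR: "M \<subseteq> R"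
    using M.a_subset by (simp only: complex_ring_simps)
  have Madd: "x + y \<in> M" if "x \<in> M" "y \<in> M" for x y
    using additive_subgroup.a_closed[OF M.is_additive_subgroup, of x y] that by (simp only: complex_ring_simps)
  have Mmult: "x * y \<in> M" if "x \<in> R" "y \<in> M" for x y
    using M.I_l_closed[of y x] that by (simp only: complex_ring_simps)
  have JI: "p / t \<in> J" if "p \<in> P" "t \<in> A - P" for p t
    using that unfolding J_def by blast
  have JE: "\<exists>p t. x = p / t \<and> p \<in> P \<and> t \<in> A - P" if "x \<in> J" for x
    using that unfolding J_def by blast
  have "ideal J (subset_ring R)"
  proof (rule ideal_subset_ringI[OF R])
    show "J \<subseteq> R"
      using JE RI PA by blast
    show "0 \<in> J"
      using JI[OF P0, of 1] A(1) P1 by simp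
    show "x + y \<in> J" if xy: "x \<in> J" "y \<in> J" for x y
    proof -
      obtain p s q t where pq: "x = p / s" "p \<in> P" "s \<in> A - P" "y = q / t" "q \<in> P" "t \<in> A - P"
        using JE[OF xy(1)] JE[OF xy(2)] by blast
      then have "t * p + s * q \<in> P"
        by (intro Padd Pmult) auto
      moreover have "x + y = (t * p + s * q) / (s * t)"
        using pq nz by (simp add: add_frac_eq mult.commute)
      ultimately show ?thesis
        using JI[OF _ denom[OF pq(3,6)]] by simp
    qed
    show "x * y \<in> J" if x: "x \<in> R" and y: "y \<in> J" for x y
    proof -
      obtain a s p t where "x = a / s" "a \<in> A" "s \<in> A - P" "y = p / t" "p \<in> P" "t \<in> A - P"
        using RE[OF x] JE[OF y] by blast
      then show ?thesis
        using JI[of "a * p" "s * t"] Pmult denom by simp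
    qed
  qed
  moreover have "P \<subseteq> J"
    using JI[of _ 1] A(1) P1 by auto
  ultimately have MJ: "M \<subseteq> J"
    using ring.genideal_minimal[OF R, of J P] by (simp add: M_def R_def local_max_ideal_def)
  \<comment> \<open>From \<open>a / s = p / t\<close> follows \<open>a * t = s * p\<close>, which
    lies in \<open>P\<close>; since \<open>t\<close> does not, primality gives
    \<open>a \<in> P\<close>.\<close>
  have num: "a \<in> P" if as: "a / s \<in> M" "a \<in> A" "s \<in> A - P" for a s
  proof -
    obtain p t where pt: "a / s = p / t" "p \<in> P" "t \<in> A - P"
      using JE[OF subsetD[OF MJ as(1)]] by blast
    then have "a * t = s * p"
      using nz[OF as(3)] nz[OF pt(3)] by (simp add: field_simps)
    then show ?thesis
      using Pmult[of s p] Pprime[of a t] pt as by auto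
  qed
  have M_prime: "x \<in> M \<or> y \<in> M" if xy: "x \<in> R" "y \<in> R" "x * y \<in> M" for x y
  proof -
    obtain a s b t where ab: "x = a / s" "a \<in> A" "s \<in> A - P" "y = b / t" "b \<in> A" "t \<in> A - P"
      using RE[OF xy(1)] RE[OF xy(2)] by blast
    then have "a * b \<in> P"
      using num[of "a * b" "s * t"] xy(3) A(5) denom by simp
    then have "a \<in> P \<or> b \<in> P"
      using Pprime ab by blast
    \<comment> \<open>Here \<open>c / u\<close> is the multiple of \<open>c\<close> by the element
      \<open>1 / u\<close> of the localization.\<close>
    moreover have "c / u \<in> M" if "c \<in> P" "u \<in> A - P" for c u
      using Mmult[of "1 / u" c] RI[OF A(1), of u] that PM by auto
    ultimately show ?thesis
      using ab by blast
  qed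
  have "1 \<notin> M" "0 \<in> M"
    using num[of 1 1] A(1) P0 P1 PM by auto
  then have "subring_prime_ideal R M"
    using R1 Rminus Radd Rmult MR Madd Mmult M_prime
    by (intro subring_prime_ideal.intro) presburger+
  then show ?thesis
    by (simp add: R_def M_def)
qed

section \<open>The cardinality bound\<close>

theorem theorem3p1:
  fixes d s :: nat
    and S :: "(real ^ 'n) set"
    and K A P :: "complex set"
    and a :: "nat \<Rightarrow> complex"
  assumes "d = CARD('n)" and "d \<ge> 1" and "s \<ge> 1"
    and "number_field K"
    and "A = ring_of_integers K"
    and "primeideal P (subset_ring A)" and "P \<noteq> {0}"
    and "complex_of_real ` squared_distances S \<subseteq> localization_at A P"
    and "\<forall>i\<in>{1..s}. a i \<in> localization_at A P"
    and "\<forall>i\<in>{1..s}. \<forall>j\<in>{1..s}. i \<noteq> j \<longrightarrow> \<not> cong_mod_ideal (a i) (a j) (local_max_ideal A P)"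
    and "\<forall>i\<in>{1..s}. \<not> cong_mod_ideal (a i) 0 (local_max_ideal A P)"
    and "\<forall>\<alpha>\<in>squared_distances S. \<exists>i\<in>{1..s}.
           cong_mod_ideal (complex_of_real \<alpha>) (a i) (local_max_ideal A P)"
  shows "finite S \<and> card S \<le> ((d + s) choose s) + ((d + s - 1) choose (s - 1))"
proof (rule finite_if_finite_subsets_card_bdd)
  \<comment> \<open>A uniform bound on the finite subsets of \<open>S\<close> yields both finiteness
    and the bound for \<open>S\<close> itself.\<close>
  fix T assume T: "T \<subseteq> S" "finite T"
  define R where "R = localization_at A P"
  define M where "M = local_max_ideal A P"
  interpret subring_prime_ideal R M
    unfolding R_def M_def using assms(6) by (rule subring_prime_ideal_localization)
  define F where "F x y = (\<Prod>i=1..s. complex_of_real ((norm (x - y))\<^sup>2) - a i)" for x y :: "real ^ 'n"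
  obtain B where B: "finite B"
    "card B \<le> ((DIM(real ^ 'n) + s) choose s) + ((DIM(real ^ 'n) + s - 1) choose (s - 1))"
    "\<And>x. F x \<in> fun_space.span B"
    using distance_polynomials_in_span[OF assms(3)] unfolding F_def by blast
  obtain e where e: "bij_betw e {0..<card T} T"
    using ex_bij_betw_nat_finite[OF T(2)] by blast
  have a: "a i \<in> R - M" if "i \<in> {1..s}" for i
    using assms(9,11) that unfolding R_def M_def cong_mod_ideal_def by auto
  have diag: "F x x \<in> R - M" for x
  proof -
    \<comment> \<open>At \<open>y = x\<close> the distance vanishes, so the factors of
      \<open>F x x\<close> are the \<open>- a i\<close>.\<close>
    have "- a i \<in> R - M" if "i \<in> {1..s}" for i
      using a[OF that] uminus_closed ideal_uminus[of "- a i"] by auto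
    then show ?thesis
      using prod_closed[of "{1..s}" "\<lambda>i. - a i"] prod_notin_ideal[of "{1..s}" "\<lambda>i. - a i"]
      by (simp add: F_def)
  qed
  have off: "F x y \<in> M" if xy: "x \<in> S" "y \<in> S" "x \<noteq> y" for x y
  proof -
    define \<alpha> where "\<alpha> = (norm (x - y))\<^sup>2"
    have \<alpha>: "\<alpha> \<in> squared_distances S"
      using xy unfolding \<alpha>_def squared_distances_def by blast
    then obtain i where i: "i \<in> {1..s}" "complex_of_real \<alpha> - a i \<in> M"
      using assms(12) unfolding cong_mod_ideal_def M_def by blast
    \<comment> \<open>One factor lies in \<open>M\<close>; the product follows it into
      \<open>M\<close> because all the others lie in \<open>R\<close>.\<close>
    have "complex_of_real \<alpha> - a j \<in> R" if "j \<in> {1..s}" for j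
    proof -
      have "complex_of_real \<alpha> \<in> R"
        using \<alpha> assms(8) unfolding R_def by blast
      then show ?thesis
        using add_closed[OF _ uminus_closed, of "complex_of_real \<alpha>" "a j"] a[OF that] by simp
    qed
    then show ?thesis
      unfolding F_def \<alpha>_def[symmetric] using i by (intro prod_in_ideal[of _ _ i]) auto
  qed
  have "det (mat (card T) (card T) (\<lambda>(i, j). F (e i) (e j))) \<noteq> 0"
  proof (rule det_neq_0_if_diagonal_mod_ideal)
    show "F (e i) (e j) \<in> M" if "i < card T" "j < card T" "i \<noteq> j" for i j
      using that T e by (intro off) (auto simp: bij_betw_def inj_on_def)
  qed (rule diag)
  \<comment> \<open>If \<open>B\<close> were smaller than \<open>T\<close>, the determinant would
    vanish.\<close>
  then have "card T \<le> card B"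
    using det_eq_0_if_small_span[OF B(1), of "card T" "\<lambda>i. F (e i)" e] B(3) by (meson not_le)
  then show "card T \<le> ((d + s) choose s) + ((d + s - 1) choose (s - 1))"
    using B(2) assms(1) by simp
qed

end
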